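(* If $(g,\xi,\lambda)$ is a Ricci soliton on an invariant submanifold $M$ of an SQ-Sasakian manifold $M^*$ with structure $(\phi,\xi,\eta,g)$, then $M$ is Einstein.
   Context: An almost contact metric manifold $(\phi,\xi,\eta,g)$ is a smooth manifold with a $(1,1)$-tensor $\phi$, a vector field $\xi$, a $1$-form $\eta$ and a Riemannian metric $g$ such that $\phi^2X=-X+\eta(X)\xi$, $\phi\xi=0$, $\eta(\xi)=1$, $g(X,\xi)=\eta(X)$, $\eta(\phi X)=0$, $g(\phi X,\phi Y)=g(X,Y)-\eta(X)\eta(Y)$, $g(\phi X,Y)=-g(X,\phi Y)$. Its fundamental $2$-form is $\Phi(X,Y)=g(X,\phi Y)$. It is normal if $[\phi X,\phi Y]+\phi^2[X,Y]-\phi[\phi X,Y]-\phi[X,\phi Y]+2d\eta(X,Y)\xi=0$. An SQ-Sasakian manifold $M^*$ (of dimension $2n+1>3$) is a normal almost contact metric manifold with $d\Phi=0$ and $\bar\nabla_X\xi=-\beta\phi X$ for a smooth function $\beta$ with $\xi\beta=0$, where $\bar\nabla$ is the Levi-Civita connection. $M$ is a submanifold of dimension $2m+1$, $m<n$, with induced metric $g$. It is invariant if $\xi$ is tangent to $M$ and $\phi(TM)\subset TM$ at every point of $M$. A Ricci soliton $(g,\xi,\lambda)$ on $M$ means that $\lambda$ is a real number and $(\pounds_\xi g)(Y,Z)+2S(Y,Z)+2\lambda g(Y,Z)=0$ for all $Y,Z$ tangent to $M$, where $S$ is the Ricci tensor of $(M,g)$ and $\pounds_\xi$ is the Lie derivative.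 Einstein means $S=c\,g$ for a constant $c$. *)

theory Defs
  imports "HOL-Analysis.Analysis"
begin

section \<open>Smooth manifolds\<close>

(* For open S: Ck_on k S f says that f is k times continuously differentiable on S. *)
primrec Ck_on :: "nat \<Rightarrow> 'e::euclidean_space set \<Rightarrow> ('e \<Rightarrow> 'v::real_normed_vector) \<Rightarrow> bool" where
  "Ck_on 0 S f \<longleftrightarrow> continuous_on S f"
| "Ck_on (Suc k) S f \<longleftrightarrow>
     (\<forall>x\<in>S. f differentiable (at x)) \<and>
     (\<forall>v. Ck_on k S (\<lambda>x. frechet_derivative f (at x) v))"

definition smooth_on :: "'e::euclidean_space set \<Rightarrow> ('e \<Rightarrow> 'v::real_normed_vector) \<Rightarrow> bool" where
  "smooth_on S f \<longleftrightarrow> (\<forall>k. Ck_on k S f)"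

record ('a, 'e) chart =
  chart_dom :: "'a set"
  chart_map :: "'a \<Rightarrow> 'e"

definition chart_img :: "('a, 'e) chart \<Rightarrow> 'e set" where
  "chart_img c = chart_map c ` chart_dom c"

definition chart_inv :: "('a, 'e) chart \<Rightarrow> 'e \<Rightarrow> 'a" where
  "chart_inv c = inv_into (chart_dom c) (chart_map c)"

(* The model space of c is allowed to differ from that of d: the same notion serves for coordinate
   changes and for the coordinate expression of the inclusion of a submanifold. *)
definition overlap :: "('a, 'e) chart \<Rightarrow> ('a, 'f) chart \<Rightarrow> 'e set" where
  "overlap c d = chart_map c ` (chart_dom c \<inter> chart_dom d)"

definition transition :: "('a, 'e) chart \<Rightarrow> ('a, 'f) chart \<Rightarrow> 'e \<Rightarrow> 'f" where
  "transition c d = chart_map d \<circ> chart_inv c"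

definition dtransition ::
  "('a, 'e::euclidean_space) chart \<Rightarrow> ('a, 'f::euclidean_space) chart \<Rightarrow> 'e \<Rightarrow> 'e \<Rightarrow> 'f" where
  "dtransition c d x = frechet_derivative (transition c d) (at x)"

record ('a, 'e) manifold =
  topo :: "'a topology"
  atlas :: "('a, 'e) chart set"

(* The dimension is that of the model space 'e; the atlas need not be maximal. *)
definition smooth_manifold :: "('a, 'e::euclidean_space) manifold \<Rightarrow> bool" where
  "smooth_manifold M \<longleftrightarrow>
     Hausdorff_space (topo M) \<and> second_countable (topo M) \<and>
     (\<Union>c\<in>atlas M. chart_dom c) = topspace (topo M) \<and>
     (\<forall>c\<in>atlas M. openin (topo M) (chart_dom c) \<and> open (chart_img c) \<and>
        homeomorphic_map (subtopology (topo M) (chart_dom c)) (top_of_set (chart_img c))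
          (chart_map c)) \<and>
     (\<forall>c\<in>atlas M. \<forall>d\<in>atlas M. smooth_on (overlap c d) (transition c d))"

definition smooth_function :: "('a, 'e::euclidean_space) manifold \<Rightarrow> ('a \<Rightarrow> real) \<Rightarrow> bool" where
  "smooth_function M f \<longleftrightarrow> (\<forall>c\<in>atlas M. smooth_on (chart_img c) (f \<circ> chart_inv c))"


section \<open>Tensor fields\<close>

(* A tensor field is the family of its coordinate expressions: for a chart c and a point x of
   chart_img c, a tangent vector at the point with coordinates x is an element of the model space,
   and the expressions in two charts are related by the derivative of the coordinate change. *)

type_synonym ('a, 'e) vfield = "('a, 'e) chart \<Rightarrow> 'e \<Rightarrow> 'e"
type_synonym ('a, 'e) form1 = "('a, 'e) chart \<Rightarrow> 'e \<Rightarrow> 'e \<Rightarrow> real"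
type_synonym ('a, 'e) tensor11 = "('a, 'e) chart \<Rightarrow> 'e \<Rightarrow> 'e \<Rightarrow> 'e"
type_synonym ('a, 'e) tensor02 = "('a, 'e) chart \<Rightarrow> 'e \<Rightarrow> 'e \<Rightarrow> 'e \<Rightarrow> real"

definition vector_field ::
  "('a, 'e::euclidean_space) manifold \<Rightarrow> ('a, 'e) vfield \<Rightarrow> bool" where
  "vector_field M V \<longleftrightarrow>
     (\<forall>c\<in>atlas M. smooth_on (chart_img c) (V c)) \<and>
     (\<forall>c\<in>atlas M. \<forall>d\<in>atlas M. \<forall>x\<in>overlap c d. V d (transition c d x) = dtransition c d x (V c x))"

definition one_form ::
  "('a, 'e::euclidean_space) manifold \<Rightarrow> ('a, 'e) form1 \<Rightarrow> bool" where
  "one_form M \<eta> \<longleftrightarrow>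
     (\<forall>c\<in>atlas M. (\<forall>x\<in>chart_img c. linear (\<eta> c x)) \<and>
        (\<forall>v. smooth_on (chart_img c) (\<lambda>x. \<eta> c x v))) \<and>
     (\<forall>c\<in>atlas M. \<forall>d\<in>atlas M. \<forall>x\<in>overlap c d. \<forall>v.
        \<eta> d (transition c d x) (dtransition c d x v) = \<eta> c x v)"

definition tensor_field11 ::
  "('a, 'e::euclidean_space) manifold \<Rightarrow> ('a, 'e) tensor11 \<Rightarrow> bool" where
  "tensor_field11 M \<phi> \<longleftrightarrow>
     (\<forall>c\<in>atlas M. (\<forall>x\<in>chart_img c. linear (\<phi> c x)) \<and>
        (\<forall>v. smooth_on (chart_img c) (\<lambda>x. \<phi> c x v))) \<and>
     (\<forall>c\<in>atlas M. \<forall>d\<in>atlas M. \<forall>x\<in>overlap c d. \<forall>v.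
        \<phi> d (transition c d x) (dtransition c d x v) = dtransition c d x (\<phi> c x v))"

definition riemannian_metric ::
  "('a, 'e::euclidean_space) manifold \<Rightarrow> ('a, 'e) tensor02 \<Rightarrow> bool" where
  "riemannian_metric M g \<longleftrightarrow>
     (\<forall>c\<in>atlas M.
        (\<forall>x\<in>chart_img c. bilinear (g c x) \<and> (\<forall>u v. g c x u v = g c x v u) \<and>
           (\<forall>u. u \<noteq> 0 \<longrightarrow> g c x u u > 0)) \<and>
        (\<forall>u v. smooth_on (chart_img c) (\<lambda>x. g c x u v))) \<and>
     (\<forall>c\<in>atlas M. \<forall>d\<in>atlas M. \<forall>x\<in>overlap c d. \<forall>u v.
        g d (transition c d x) (dtransition c d x u) (dtransition c d x v) = g c x u v)"


section \<open>Calculus on coordinate domains\<close>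

(* In this section X, Y, Z are coordinate expressions of vector fields, \<omega>, \<Phi>, g of a 1-form, a
   2-form and a metric, on the image of one chart. All the identities imposed below are local, so
   they are required for all smooth vector fields on each coordinate domain. *)

definition dir_deriv :: "('e::euclidean_space \<Rightarrow> 'e) \<Rightarrow> ('e \<Rightarrow> real) \<Rightarrow> 'e \<Rightarrow> real" where
  "dir_deriv X f x = frechet_derivative f (at x) (X x)"

definition lie_bracket :: "('e::euclidean_space \<Rightarrow> 'e) \<Rightarrow> ('e \<Rightarrow> 'e) \<Rightarrow> 'e \<Rightarrow> 'e" where
  "lie_bracket X Y x =
     frechet_derivative Y (at x) (X x) - frechet_derivative X (at x) (Y x)"

(* The exterior derivative of a k-form carries the factor 1/(k+1). This is the normalisation for
   which the term 2 d\<eta>(X,Y)\<xi> in the normality condition is the right one: d\<eta> = \<Phi> on a Sasakian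
   manifold with \<nabla>\<^sub>X\<xi> = -\<phi>X. *)
definition ext_deriv1 ::
  "('e::euclidean_space \<Rightarrow> 'e \<Rightarrow> real) \<Rightarrow> ('e \<Rightarrow> 'e) \<Rightarrow> ('e \<Rightarrow> 'e) \<Rightarrow> 'e \<Rightarrow> real" where
  "ext_deriv1 \<omega> X Y x =
     (dir_deriv X (\<lambda>y. \<omega> y (Y y)) x - dir_deriv Y (\<lambda>y. \<omega> y (X y)) x
        - \<omega> x (lie_bracket X Y x)) / 2"

definition ext_deriv2 ::
  "('e::euclidean_space \<Rightarrow> 'e \<Rightarrow> 'e \<Rightarrow> real) \<Rightarrow> ('e \<Rightarrow> 'e) \<Rightarrow> ('e \<Rightarrow> 'e) \<Rightarrow> ('e \<Rightarrow> 'e) \<Rightarrow> 'e \<Rightarrow> real"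
  where
  "ext_deriv2 \<Phi> X Y Z x =
     (dir_deriv X (\<lambda>y. \<Phi> y (Y y) (Z y)) x + dir_deriv Y (\<lambda>y. \<Phi> y (Z y) (X y)) x
        + dir_deriv Z (\<lambda>y. \<Phi> y (X y) (Y y)) x
        - \<Phi> x (lie_bracket X Y x) (Z x) - \<Phi> x (lie_bracket Y Z x) (X x)
        - \<Phi> x (lie_bracket Z X x) (Y x)) / 3"

definition lie_deriv_metric ::
  "('e::euclidean_space \<Rightarrow> 'e) \<Rightarrow> ('e \<Rightarrow> 'e \<Rightarrow> 'e \<Rightarrow> real) \<Rightarrow> ('e \<Rightarrow> 'e) \<Rightarrow> ('e \<Rightarrow> 'e) \<Rightarrow> 'e \<Rightarrow> real" where
  "lie_deriv_metric V g Y Z x =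
     dir_deriv V (\<lambda>y. g y (Y y) (Z y)) x
       - g x (lie_bracket V Y x) (Z x) - g x (Y x) (lie_bracket V Z x)"

(* On a coordinate domain every connection is \<nabla>\<^sub>XY = DY(X) + \<Gamma>(X,Y) with \<Gamma> bilinear at each
   point; it is torsion-free iff \<Gamma> is symmetric, and the last condition is \<nabla>g = 0 evaluated on
   constant fields. Existence and uniqueness are christoffel_ex1 below. *)
definition is_christoffel ::
  "('e::euclidean_space \<Rightarrow> 'e \<Rightarrow> 'e \<Rightarrow> real) \<Rightarrow> 'e \<Rightarrow> ('e \<Rightarrow> 'e \<Rightarrow> 'e) \<Rightarrow> bool" where
  "is_christoffel g x \<Gamma> \<longleftrightarrow>
     bilinear \<Gamma> \<and> (\<forall>u v. \<Gamma> u v = \<Gamma> v u) \<and>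
     (\<forall>u v w. frechet_derivative (\<lambda>y. g y v w) (at x) u = g x (\<Gamma> u v) w + g x v (\<Gamma> u w))"

definition christoffel :: "('e::euclidean_space \<Rightarrow> 'e \<Rightarrow> 'e \<Rightarrow> real) \<Rightarrow> 'e \<Rightarrow> 'e \<Rightarrow> 'e \<Rightarrow> 'e" where
  "christoffel g x = (THE \<Gamma>. is_christoffel g x \<Gamma>)"

definition levi_civita ::
  "('e::euclidean_space \<Rightarrow> 'e \<Rightarrow> 'e \<Rightarrow> real) \<Rightarrow> ('e \<Rightarrow> 'e) \<Rightarrow> ('e \<Rightarrow> 'e) \<Rightarrow> 'e \<Rightarrow> 'e" where
  "levi_civita g X Y x = frechet_derivative Y (at x) (X x) + christoffel g x (X x) (Y x)"

definition curvature ::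
  "('e::euclidean_space \<Rightarrow> 'e \<Rightarrow> 'e \<Rightarrow> real) \<Rightarrow> ('e \<Rightarrow> 'e) \<Rightarrow> ('e \<Rightarrow> 'e) \<Rightarrow> ('e \<Rightarrow> 'e) \<Rightarrow> 'e \<Rightarrow> 'e" where
  "curvature g X Y Z x =
     levi_civita g X (levi_civita g Y Z) x - levi_civita g Y (levi_civita g X Z) x
       - levi_civita g (lie_bracket X Y) Z x"

(* S(Y,Z) = trace (X \<mapsto> R(X,Y)Z); the trace is computed in the coordinate basis. *)
definition ricci ::
  "('e::euclidean_space \<Rightarrow> 'e \<Rightarrow> 'e \<Rightarrow> real) \<Rightarrow> ('e \<Rightarrow> 'e) \<Rightarrow> ('e \<Rightarrow> 'e) \<Rightarrow> 'e \<Rightarrow> real" where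
  "ricci g Y Z x = (\<Sum>b\<in>Basis. curvature g (\<lambda>_. b) Y Z x \<bullet> b)"


section \<open>Almost contact metric and SQ-Sasakian manifolds\<close>

definition almost_contact_metric ::
  "('a, 'e::euclidean_space) manifold \<Rightarrow> ('a, 'e) tensor11 \<Rightarrow> ('a, 'e) vfield \<Rightarrow> ('a, 'e) form1
     \<Rightarrow> ('a, 'e) tensor02 \<Rightarrow> bool" where
  "almost_contact_metric M \<phi> \<xi> \<eta> g \<longleftrightarrow>
     smooth_manifold M \<and> tensor_field11 M \<phi> \<and> vector_field M \<xi> \<and> one_form M \<eta> \<and>
     riemannian_metric M g \<and>
     (\<forall>c\<in>atlas M. \<forall>x\<in>chart_img c.
        (\<forall>u. \<phi> c x (\<phi> c x u) = - u + \<eta> c x u *\<^sub>R \<xi> c x) \<and>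
        \<phi> c x (\<xi> c x) = 0 \<and>
        \<eta> c x (\<xi> c x) = 1 \<and>
        (\<forall>u. g c x u (\<xi> c x) = \<eta> c x u) \<and>
        (\<forall>u. \<eta> c x (\<phi> c x u) = 0) \<and>
        (\<forall>u v. g c x (\<phi> c x u) (\<phi> c x v) = g c x u v - \<eta> c x u * \<eta> c x v) \<and>
        (\<forall>u v. g c x (\<phi> c x u) v = - g c x u (\<phi> c x v)))"

definition fundamental_form ::
  "('a, 'e) tensor11 \<Rightarrow> ('a, 'e) tensor02 \<Rightarrow> ('a, 'e) tensor02" where
  "fundamental_form \<phi> g c x u v = g c x u (\<phi> c x v)"

definition normal_structure ::
  "('a, 'e::euclidean_space) manifold \<Rightarrow> ('a, 'e) tensor11 \<Rightarrow> ('a, 'e) vfield \<Rightarrow> ('a, 'e) form1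
     \<Rightarrow> bool" where
  "normal_structure M \<phi> \<xi> \<eta> \<longleftrightarrow>
     (\<forall>c\<in>atlas M. \<forall>X Y. smooth_on (chart_img c) X \<longrightarrow> smooth_on (chart_img c) Y \<longrightarrow>
        (\<forall>x\<in>chart_img c.
           let \<phi>X = (\<lambda>y. \<phi> c y (X y)); \<phi>Y = (\<lambda>y. \<phi> c y (Y y)) in
           lie_bracket \<phi>X \<phi>Y x + \<phi> c x (\<phi> c x (lie_bracket X Y x))
             - \<phi> c x (lie_bracket \<phi>X Y x) - \<phi> c x (lie_bracket X \<phi>Y x)
             + (2 * ext_deriv1 (\<eta> c) X Y x) *\<^sub>R \<xi> c x = 0))"

definition closed_form2 ::
  "('a, 'e::euclidean_space) manifold \<Rightarrow> ('a, 'e) tensor02 \<Rightarrow> bool" where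
  "closed_form2 M \<Phi> \<longleftrightarrow>
     (\<forall>c\<in>atlas M. \<forall>X Y Z. smooth_on (chart_img c) X \<longrightarrow> smooth_on (chart_img c) Y \<longrightarrow>
        smooth_on (chart_img c) Z \<longrightarrow> (\<forall>x\<in>chart_img c. ext_deriv2 (\<Phi> c) X Y Z x = 0))"

definition sq_sasakian ::
  "('a, 'e::euclidean_space) manifold \<Rightarrow> ('a, 'e) tensor11 \<Rightarrow> ('a, 'e) vfield \<Rightarrow> ('a, 'e) form1
     \<Rightarrow> ('a, 'e) tensor02 \<Rightarrow> bool" where
  "sq_sasakian M \<phi> \<xi> \<eta> g \<longleftrightarrow>
     almost_contact_metric M \<phi> \<xi> \<eta> g \<and>
     normal_structure M \<phi> \<xi> \<eta> \<and>
     closed_form2 M (fundamental_form \<phi> g) \<and>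
     (\<exists>\<beta>. smooth_function M \<beta> \<and>
        (\<forall>c\<in>atlas M. \<forall>x\<in>chart_img c. dir_deriv (\<xi> c) (\<beta> \<circ> chart_inv c) x = 0) \<and>
        (\<forall>c\<in>atlas M. \<forall>X. smooth_on (chart_img c) X \<longrightarrow>
           (\<forall>x\<in>chart_img c.
              levi_civita (g c) X (\<xi> c) x = - (\<beta> (chart_inv c x) *\<^sub>R \<phi> c x (X x)))))"


section \<open>Invariant submanifolds and Ricci solitons\<close>

(* N is an immersed submanifold of M: its points are points of M, and the inclusion is a smooth
   immersion. Its topology may be finer than the one induced by M. *)
definition submanifold ::
  "('a, 'f::euclidean_space) manifold \<Rightarrow> ('a, 'e::euclidean_space) manifold \<Rightarrow> bool" where
  "submanifold N M \<longleftrightarrow>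
     smooth_manifold N \<and> topspace (topo N) \<subseteq> topspace (topo M) \<and>
     continuous_map (topo N) (topo M) id \<and>
     (\<forall>c\<in>atlas N. \<forall>d\<in>atlas M. smooth_on (overlap c d) (transition c d) \<and>
        (\<forall>x\<in>overlap c d. inj (dtransition c d x)))"

definition chart_at :: "('a, 'e) manifold \<Rightarrow> 'a \<Rightarrow> ('a, 'e) chart" where
  "chart_at M p = (SOME d. d \<in> atlas M \<and> p \<in> chart_dom d)"

(* By the transformation laws of g and V the choice of d does not matter. *)
definition induced_metric ::
  "('a, 'e::euclidean_space) manifold \<Rightarrow> ('a, 'e) tensor02 \<Rightarrow> ('a, 'f::euclidean_space) tensor02"
  where
  "induced_metric M g c x u v =
     (let d = chart_at M (chart_inv c x)
      in g d (transition c d x) (dtransition c d x u) (dtransition c d x v))"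

definition restrict_field ::
  "('a, 'e::euclidean_space) manifold \<Rightarrow> ('a, 'e) vfield \<Rightarrow> ('a, 'f::euclidean_space) vfield" where
  "restrict_field M V c x =
     (let d = chart_at M (chart_inv c x) in THE v. dtransition c d x v = V d (transition c d x))"

definition invariant_submanifold ::
  "('a, 'f::euclidean_space) manifold \<Rightarrow> ('a, 'e::euclidean_space) manifold
     \<Rightarrow> ('a, 'e) tensor11 \<Rightarrow> ('a, 'e) vfield \<Rightarrow> bool" where
  "invariant_submanifold N M \<phi> \<xi> \<longleftrightarrow>
     submanifold N M \<and>
     (\<forall>c\<in>atlas N. \<forall>d\<in>atlas M. \<forall>x\<in>overlap c d.
        \<xi> d (transition c d x) \<in> range (dtransition c d x) \<and>
        \<phi> d (transition c d x) ` range (dtransition c d x) \<subseteq> range (dtransition c d x))"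

definition ricci_soliton ::
  "('a, 'e::euclidean_space) manifold \<Rightarrow> ('a, 'e) tensor02 \<Rightarrow> ('a, 'e) vfield \<Rightarrow> real \<Rightarrow> bool" where
  "ricci_soliton M g V lam \<longleftrightarrow>
     riemannian_metric M g \<and> vector_field M V \<and>
     (\<forall>c\<in>atlas M. \<forall>Y Z. smooth_on (chart_img c) Y \<longrightarrow> smooth_on (chart_img c) Z \<longrightarrow>
        (\<forall>x\<in>chart_img c.
           lie_deriv_metric (V c) (g c) Y Z x + 2 * ricci (g c) Y Z x
             + 2 * lam * g c x (Y x) (Z x) = 0))"

definition einstein ::
  "('a, 'e::euclidean_space) manifold \<Rightarrow> ('a, 'e) tensor02 \<Rightarrow> bool" where
  "einstein M g \<longleftrightarrow>
     (\<exists>a::real. \<forall>c\<in>atlas M. \<forall>Y Z. smooth_on (chart_img c) Y \<longrightarrow> smooth_on (chart_img c) Z \<longrightarrow>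
        (\<forall>x\<in>chart_img c. ricci (g c) Y Z x = a * g c x (Y x) (Z x)))"


section \<open>Existence and uniqueness of the Levi-Civita connection\<close>

lemma smooth_on_differentiable:
  assumes "smooth_on S f" "x \<in> S"
  shows "f differentiable (at x)"
  using assms unfolding smooth_on_def by (metis Ck_on.simps(2))

lemma metric_riesz:
  fixes G :: "'e::euclidean_space \<Rightarrow> 'e \<Rightarrow> real"
  assumes b: "bilinear G" and pos: "\<And>u. u \<noteq> 0 \<Longrightarrow> G u u > 0" and l: "linear L"
  shows "\<exists>!w. \<forall>z. G w z = L z"
proof (rule ex_ex1I)
  define T where "T w = (\<Sum>b\<in>Basis. G w b *\<^sub>R b)" for w
  have linl: "linear (\<lambda>w. G w z)" and linr: "linear (G w)" for w z
    using b by (auto simp: bilinear_def)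
  have T_inner: "T w \<bullet> b = G w b" if "b \<in> Basis" for w b
    using that by (simp add: T_def inner_sum_left inner_Basis if_distrib cong: if_cong)
  have linT: "linear T"
    unfolding T_def by (intro linear_compose_sum ballI linearI)
      (simp_all add: linear_add[OF linl] linear_cmul[OF linl] scaleR_add_left)
  have eqI: "F = H" if "linear F" "linear H" "\<And>b. b \<in> Basis \<Longrightarrow> F b = (H b :: real)" for F H :: "'e \<Rightarrow> real"
    using linear_eq_on_span[OF that(1,2), of Basis] that(3) by auto
  have "inj T"
    unfolding linear_injective_0[OF linT]
  proof (intro allI impI)
    fix w assume "T w = 0"
    then have "G w = (\<lambda>_. 0)"
      using T_inner[of _ w] by (intro eqI linr linear_zero) auto
    then show "w = 0" using pos[of w] by fastforce
  qed
  then have "surj T" using linT by (simp add: linear_injective_imp_surjective)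
  then obtain w where w: "T w = (\<Sum>b\<in>Basis. L b *\<^sub>R b)" by (metis surjD)
  have "G w = L"
  proof (intro eqI linr l)
    fix b :: 'e assume "b \<in> Basis"
    then show "G w b = L b"
      using T_inner[of b w] unfolding w by (simp add: inner_sum_left inner_Basis if_distrib cong: if_cong)
  qed
  then show "\<exists>w. \<forall>z. G w z = L z" by metis
next
  fix w w' assume *: "\<forall>z. G w z = L z" "\<forall>z. G w' z = L z"
  have "G (w - w') (w - w') = 0" using * by (simp add: bilinear_lsub[OF b])
  then show "w = w'" using pos[of "w - w'"] by force
qed

lemma christoffel_ex1:
  assumes M: "riemannian_metric M g" and c: "c \<in> atlas M" and op: "open (chart_img c)"
    and x: "x \<in> chart_img c"
  shows "\<exists>!\<Gamma>. is_christoffel (g c) x \<Gamma>"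
proof -
  define G where "G = g c x"
  define D where "D u v w = frechet_derivative (\<lambda>y. g c y v w) (at x) u" for u v w
  have bil: "bilinear (g c y)" and sym: "g c y u v = g c y v u"
    and pos: "u \<noteq> 0 \<Longrightarrow> g c y u u > 0" if "y \<in> chart_img c" for y u v
    using M c that by (auto simp: riemannian_metric_def)
  have dif: "(\<lambda>y. g c y u v) differentiable (at x)" for u v
    using M c x by (intro smooth_on_differentiable[OF _ x]) (auto simp: riemannian_metric_def)
  have Gb: "bilinear G" and Gs: "\<And>u v. G u v = G v u" and Gp: "\<And>u. u \<noteq> 0 \<Longrightarrow> G u u > 0"
    using bil sym pos x by (auto simp: G_def)
  have D1: "linear (\<lambda>u. D u v w)" for v w
    unfolding D_def using linear_frechet_derivative[OF dif] by simp
  have Ds: "D u v w = D u w v" for u v w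
  proof -
    have "frechet_derivative (\<lambda>y. g c y v w) (at x) = frechet_derivative (\<lambda>y. g c y w v) (at x)"
      using dif op x by (rule frechet_derivative_transform_within_open) (simp add: sym)
    then show ?thesis by (simp add: D_def)
  qed
  have hd: "((\<lambda>y. g c y v w) has_derivative (\<lambda>u. D u v w)) (at x)" for v w
    unfolding D_def using dif by (simp add: frechet_derivative_works)
  have D3: "linear (\<lambda>w. D u v w)" for u v
  proof (rule linearI)
    fix w w'
    have "((\<lambda>y. g c y v (w + w')) has_derivative (\<lambda>u. D u v w + D u v w')) (at x)"
      by (rule has_derivative_transform_within_open[OF has_derivative_add[OF hd hd] op x])
        (simp add: bilinear_radd[OF bil])
    then show "D u v (w + w') = D u v w + D u v w'"
      using has_derivative_unique[OF hd] by metis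
  next
    fix r w
    have "((\<lambda>y. g c y v (r *\<^sub>R w)) has_derivative (\<lambda>u. r *\<^sub>R D u v w)) (at x)"
      by (rule has_derivative_transform_within_open[OF has_derivative_scaleR_right[OF hd] op x])
        (simp add: bilinear_rmul[OF bil])
    then show "D u v (r *\<^sub>R w) = r *\<^sub>R D u v w"
      using has_derivative_unique[OF hd] by metis
  qed
  have D2: "linear (\<lambda>v. D u v w)" for u w
    using D3[of u w] by (simp add: Ds[of u _ w])
  define K where "K u v z = (D u v z + D v u z - D z u v) / 2" for u v z
  have K3: "linear (K u v)" for u v
    by (rule linearI) (simp_all add: K_def linear_add[OF D3] linear_add[OF D1] linear_cmul[OF D3]
      linear_cmul[OF D1] algebra_simps add_divide_distrib diff_divide_distrib)
  have K1: "K (u + u') v z = K u v z + K u' v z" "K (r *\<^sub>R u) v z = r * K u v z" for u u' v z r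
    by (simp_all add: K_def linear_add[OF D1] linear_add[OF D2] linear_cmul[OF D1]
      linear_cmul[OF D2] algebra_simps add_divide_distrib diff_divide_distrib)
  have Ks: "K u v z = K v u z" for u v z
    using Ds[of z u v] by (simp add: K_def)
  have "\<exists>w. \<forall>z. G w z = K u v z" for u v
    using metric_riesz[OF Gb Gp K3[of u v]] by blast
  then obtain \<Gamma> where \<Gamma>: "\<And>u v z. G (\<Gamma> u v) z = K u v z" by metis
  have nondeg: "w = w'" if "\<And>z. G w z = G w' z" for w w'
    using metric_riesz[OF Gb Gp, of "G w'"] Gb that by (auto simp: bilinear_def)
  have \<Gamma>s: "\<Gamma> u v = \<Gamma> v u" for u v
    by (rule nondeg) (simp add: \<Gamma> Ks[of u v])
  have \<Gamma>1: "linear (\<lambda>u. \<Gamma> u v)" for v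
    by (rule linearI; rule nondeg)
      (simp_all add: \<Gamma> K1 bilinear_ladd[OF Gb] bilinear_lmul[OF Gb])
  then have "bilinear \<Gamma>"
    using \<Gamma>s by (simp add: bilinear_def)
  moreover have "D u v w = G (\<Gamma> u v) w + G v (\<Gamma> u w)" for u v w
    using Ds[of u v w] Ds[of v u w] Ds[of w u v]
    by (simp add: \<Gamma> Gs[of v] K_def field_simps)
  ultimately have "is_christoffel (g c) x \<Gamma>"
    using \<Gamma>s by (simp add: is_christoffel_def D_def G_def)
  moreover have "\<Delta> = \<Gamma>" if "is_christoffel (g c) x \<Delta>" for \<Delta>
  proof (intro ext nondeg)
    fix u v z
    have s: "\<Delta> u v = \<Delta> v u" and m: "D u v w = G (\<Delta> u v) w + G v (\<Delta> u w)" for u v w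
      using that unfolding is_christoffel_def D_def G_def by blast+
    have "2 * K u v z = 2 * G (\<Delta> u v) z"
      using m[of u v z] m[of v u z] m[of z u v] s[of u v] s[of u z] s[of v z]
        Gs[of u "\<Delta> v z"] Gs[of v "\<Delta> u z"] Gs[of "\<Delta> z u" v]
      by (simp add: K_def)
    then show "G (\<Delta> u v) z = G (\<Gamma> u v) z" by (simp add: \<Gamma>)
  qed
  ultimately show ?thesis by blast
qed

lemma is_christoffel_christoffel:
  assumes "riemannian_metric M g" "c \<in> atlas M" "open (chart_img c)" "x \<in> chart_img c"
  shows "is_christoffel (g c) x (christoffel (g c) x)"
  using theI'[OF christoffel_ex1[OF assms]] by (simp only: christoffel_def)

lemma levi_civita_torsion_free:
  assumes "riemannian_metric M g" "c \<in> atlas M" "open (chart_img c)" "x \<in> chart_img c"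
  shows "levi_civita (g c) X Y x - levi_civita (g c) Y X x = lie_bracket X Y x"
proof -
  have "christoffel (g c) x (X x) (Y x) = christoffel (g c) x (Y x) (X x)"
    using is_christoffel_christoffel[OF assms] unfolding is_christoffel_def by blast
  then show ?thesis by (simp add: levi_civita_def lie_bracket_def)
qed

lemma levi_civita_metric:
  fixes M :: "('a, 'e::euclidean_space) manifold"
  assumes M: "riemannian_metric M g" and c: "c \<in> atlas M" and op: "open (chart_img c)"
    and x: "x \<in> chart_img c"
    and Y: "Y differentiable (at x)" and Z: "Z differentiable (at x)"
  shows "dir_deriv X (\<lambda>y. g c y (Y y) (Z y)) x =
    g c x (levi_civita (g c) X Y x) (Z x) + g c x (Y x) (levi_civita (g c) X Z x)"
proof -
  have bil: "bilinear (g c y)" if "y \<in> chart_img c" for y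
    using M c that by (auto simp: riemannian_metric_def)
  define D where "D u v w = frechet_derivative (\<lambda>y. g c y v w) (at x) u" for u v w
  define DY where "DY = frechet_derivative Y (at x)"
  define DZ where "DZ = frechet_derivative Z (at x)"
  have hg: "((\<lambda>y. g c y v w) has_derivative (\<lambda>u. D u v w)) (at x)" for v w
  proof -
    have "smooth_on (chart_img c) (\<lambda>y. g c y v w)"
      using M c by (auto simp: riemannian_metric_def)
    from smooth_on_differentiable[OF this x] show ?thesis
      by (simp add: D_def frechet_derivative_works)
  qed
  have hY: "(Y has_derivative DY) (at x)" and hZ: "(Z has_derivative DZ) (at x)"
    using Y Z by (auto simp: DY_def DZ_def frechet_derivative_works)
  have expand: "B u v = (\<Sum>i\<in>Basis. \<Sum>j\<in>Basis. (u \<bullet> i) * (v \<bullet> j) * B i j)"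
    if "bilinear B" for B :: "'e \<Rightarrow> 'e \<Rightarrow> real" and u v
  proof -
    have "B u v = B (\<Sum>i\<in>Basis. (u \<bullet> i) *\<^sub>R i) (\<Sum>j\<in>Basis. (v \<bullet> j) *\<^sub>R j)"
      by (simp add: euclidean_representation)
    also have "\<dots> = (\<Sum>i\<in>Basis. \<Sum>j\<in>Basis. B ((u \<bullet> i) *\<^sub>R i) ((v \<bullet> j) *\<^sub>R j))"
      by (simp add: bilinear_sum[OF that] sum.cartesian_product)
    finally show ?thesis
      by (simp add: bilinear_lmul[OF that] bilinear_rmul[OF that] mult_ac)
  qed
  have ch: "D u v w = g c x (christoffel (g c) x u v) w + g c x v (christoffel (g c) x u w)" for u v w
    using is_christoffel_christoffel[OF M c op x] unfolding is_christoffel_def D_def by blast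
  have bch: "bilinear (christoffel (g c) x)"
    using is_christoffel_christoffel[OF M c op x] unfolding is_christoffel_def by blast
  have bD: "bilinear (D u)" for u
    unfolding bilinear_def
    by (auto intro!: linearI simp: ch bilinear_ladd[OF bil[OF x]] bilinear_radd[OF bil[OF x]]
      bilinear_lmul[OF bil[OF x]] bilinear_rmul[OF bil[OF x]] bilinear_ladd[OF bch]
      bilinear_radd[OF bch] bilinear_lmul[OF bch] bilinear_rmul[OF bch] algebra_simps)
  have "((\<lambda>y. \<Sum>i\<in>Basis. \<Sum>j\<in>Basis. (Y y \<bullet> i) * (Z y \<bullet> j) * g c y i j) has_derivative
      (\<lambda>u. \<Sum>i\<in>Basis. \<Sum>j\<in>Basis. (Y x \<bullet> i) * (Z x \<bullet> j) * D u i j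
        + ((Y x \<bullet> i) * (DZ u \<bullet> j) + (DY u \<bullet> i) * (Z x \<bullet> j)) * g c x i j)) (at x)"
    by (intro has_derivative_sum has_derivative_mult hg has_derivative_inner_left hY hZ)
  moreover have "(\<Sum>i\<in>Basis. \<Sum>j\<in>Basis. (Y x \<bullet> i) * (Z x \<bullet> j) * D u i j
        + ((Y x \<bullet> i) * (DZ u \<bullet> j) + (DY u \<bullet> i) * (Z x \<bullet> j)) * g c x i j)
      = D u (Y x) (Z x) + (g c x (Y x) (DZ u) + g c x (DY u) (Z x))" for u
    using expand[OF bD, of u "Y x" "Z x"] expand[OF bil[OF x], of "Y x" "DZ u"]
      expand[OF bil[OF x], of "DY u" "Z x"]
    by (simp only: sum.distrib distrib_right)
  ultimately have "((\<lambda>y. \<Sum>i\<in>Basis. \<Sum>j\<in>Basis. (Y y \<bullet> i) * (Z y \<bullet> j) * g c y i j)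
      has_derivative (\<lambda>u. D u (Y x) (Z x) + (g c x (Y x) (DZ u) + g c x (DY u) (Z x)))) (at x)"
    by (simp only:)
  then have "((\<lambda>y. g c y (Y y) (Z y)) has_derivative
      (\<lambda>u. D u (Y x) (Z x) + (g c x (Y x) (DZ u) + g c x (DY u) (Z x)))) (at x)"
    by (rule has_derivative_transform_within_open[OF _ op x]) (rule expand[OF bil, symmetric])
  then have "dir_deriv X (\<lambda>y. g c y (Y y) (Z y)) x
      = D (X x) (Y x) (Z x) + (g c x (Y x) (DZ (X x)) + g c x (DY (X x)) (Z x))"
    unfolding dir_deriv_def by (simp only: frechet_derivative_at[symmetric])
  then show ?thesis
    by (simp add: levi_civita_def ch DY_def DZ_def bilinear_ladd[OF bil[OF x]]
      bilinear_radd[OF bil[OF x]])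
qed

end

theory Submission
  imports Defs
begin

text \<open>
  Since \<open>\<nabla>\<^sub>X\<xi> = -\<beta>\<phi>X\<close> and \<open>\<phi>\<close> is skew, \<open>\<xi>\<close> is a Killing field of the ambient manifold.
  It is tangent to the submanifold, so its restriction is related to \<open>\<xi>\<close> by the inclusion; as the
  Lie derivative commutes with pullbacks along related fields, the restriction is a Killing field
  of the induced metric. The soliton equation then reads \<open>S = -\<lambda> g\<close>.
\<close>

section \<open>Symmetry of second derivatives\<close>

text \<open>The mean value theorem is applied twice: in \<open>s\<close> to \<open>f\<close> at
  \<open>x + s u + t v\<close> minus \<open>f\<close> at \<open>x + s u\<close>, whose increment
  from 0 to \<open>t\<close> is the double difference, and then in \<open>r\<close> to the
  derivative of \<open>f\<close> in direction \<open>u\<close>. Second derivatives are those of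
  \<open>f'\<close> in a fixed direction because \<open>Ck_on\<close> iterates exactly such
  derivatives.\<close>

lemma double_difference_mvt:
  fixes f :: "'e::real_normed_vector \<Rightarrow> real"
  assumes t: "t > 0"
    and S: "\<And>s r. 0 \<le> s \<Longrightarrow> s \<le> t \<Longrightarrow> 0 \<le> r \<Longrightarrow> r \<le> t \<Longrightarrow> x + s *\<^sub>R u + r *\<^sub>R v \<in> S"
    and f: "\<And>y. y \<in> S \<Longrightarrow> (f has_derivative f' y) (at y)"
    and fu: "\<And>y. y \<in> S \<Longrightarrow> ((\<lambda>y. f' y u) has_derivative fu y) (at y)"
  obtains s r where "0 \<le> s" "s \<le> t" "0 \<le> r" "r \<le> t"
    "f (x + t *\<^sub>R u + t *\<^sub>R v) - f (x + t *\<^sub>R u) - f (x + t *\<^sub>R v) + f x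
      = t * t * fu (x + s *\<^sub>R u + r *\<^sub>R v) v"
proof -
  have "((\<lambda>s. f (x + s *\<^sub>R u + t *\<^sub>R v) - f (x + s *\<^sub>R u)) has_derivative
      (\<lambda>h. f' (x + s *\<^sub>R u + t *\<^sub>R v) (h *\<^sub>R u) - f' (x + s *\<^sub>R u) (h *\<^sub>R u))) (at s)"
    if "0 \<le> s" "s \<le> t" for s
  proof -
    have "((\<lambda>s. x + s *\<^sub>R u + t *\<^sub>R v) has_derivative (\<lambda>h. h *\<^sub>R u)) (at s)"
      by (auto intro!: derivative_eq_intros)
    moreover have "((\<lambda>s. x + s *\<^sub>R u) has_derivative (\<lambda>h. h *\<^sub>R u)) (at s)"
      by (auto intro!: derivative_eq_intros)
    ultimately show ?thesis
      using S[of s t] S[of s 0] t that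
      by (intro has_derivative_diff has_derivative_compose[OF _ f]) auto
  qed
  then obtain s where s: "0 < s" "s < t" and
    1: "(f (x + t *\<^sub>R u + t *\<^sub>R v) - f (x + t *\<^sub>R u)) - (f (x + 0 *\<^sub>R u + t *\<^sub>R v) - f (x + 0 *\<^sub>R u))
      = f' (x + s *\<^sub>R u + t *\<^sub>R v) ((t - 0) *\<^sub>R u) - f' (x + s *\<^sub>R u) ((t - 0) *\<^sub>R u)"
    using mvt_simple[OF t, of "\<lambda>s. f (x + s *\<^sub>R u + t *\<^sub>R v) - f (x + s *\<^sub>R u)"
        "\<lambda>s h. f' (x + s *\<^sub>R u + t *\<^sub>R v) (h *\<^sub>R u) - f' (x + s *\<^sub>R u) (h *\<^sub>R u)"]
    by (force intro: has_derivative_at_withinI)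
  have hom: "f' y (t *\<^sub>R u) = t * f' y u" if "y \<in> S" for y
    using linear_cmul[OF has_derivative_linear[OF f[OF that]]] by simp
  have "((\<lambda>r. f' (x + s *\<^sub>R u + r *\<^sub>R v) u) has_derivative
      (\<lambda>h. fu (x + s *\<^sub>R u + r *\<^sub>R v) (h *\<^sub>R v))) (at r)"
    if "0 \<le> r" "r \<le> t" for r
  proof -
    have "((\<lambda>r. x + s *\<^sub>R u + r *\<^sub>R v) has_derivative (\<lambda>h. h *\<^sub>R v)) (at r)"
      by (auto intro!: derivative_eq_intros)
    then show ?thesis
      using S[of s r] s that by (intro has_derivative_compose[OF _ fu]) auto
  qed
  then obtain r where r: "0 < r" "r < t" and
    2: "f' (x + s *\<^sub>R u + t *\<^sub>R v) u - f' (x + s *\<^sub>R u + 0 *\<^sub>R v) u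
      = fu (x + s *\<^sub>R u + r *\<^sub>R v) ((t - 0) *\<^sub>R v)"
    using mvt_simple[OF t, of "\<lambda>r. f' (x + s *\<^sub>R u + r *\<^sub>R v) u"
        "\<lambda>r h. fu (x + s *\<^sub>R u + r *\<^sub>R v) (h *\<^sub>R v)"]
    by (force intro: has_derivative_at_withinI)
  have "fu (x + s *\<^sub>R u + r *\<^sub>R v) (t *\<^sub>R v) = t * fu (x + s *\<^sub>R u + r *\<^sub>R v) v"
    using S[of s r] s r linear_cmul[OF has_derivative_linear[OF fu]] by simp
  then have "f (x + t *\<^sub>R u + t *\<^sub>R v) - f (x + t *\<^sub>R u) - f (x + t *\<^sub>R v) + f x
      = t * t * fu (x + s *\<^sub>R u + r *\<^sub>R v) v"
    using 1 2 hom[OF S[of s t]] hom[OF S[of s 0]] s t by (simp add: algebra_simps)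
  with s r show ?thesis by (intro that[of s r]) auto
qed

text \<open>The double difference does not change when \<open>u\<close> and \<open>v\<close> are
  exchanged, so it equals \<open>t * t\<close> times either mixed derivative, each taken at some
  point of a small parallelogram at \<open>x\<close>. For small \<open>t\<close>, continuity at
  \<open>x\<close> then excludes a gap between the two values at \<open>x\<close>.\<close>

lemma second_derivative_symmetric_real:
  fixes f :: "'e::real_normed_vector \<Rightarrow> real"
  assumes "open S" "x \<in> S"
    and f: "\<And>y. y \<in> S \<Longrightarrow> (f has_derivative f' y) (at y)"
    and fu: "\<And>y. y \<in> S \<Longrightarrow> ((\<lambda>y. f' y u) has_derivative fu y) (at y)"
    and fv: "\<And>y. y \<in> S \<Longrightarrow> ((\<lambda>y. f' y v) has_derivative fv y) (at y)"
    and cu: "continuous (at x) (\<lambda>y. fu y v)" and cv: "continuous (at x) (\<lambda>y. fv y u)"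
  shows "fu x v = fv x u"
proof (rule ccontr)
  \<comment> \<open>Half the gap: a value closer than \<open>e\<close> to \<open>fu x v\<close>
    cannot equal one closer than \<open>e\<close> to \<open>fv x u\<close>.\<close>
  define e where "e = dist (fu x v) (fv x u) / 2"
  assume "fu x v \<noteq> fv x u"
  then have e: "e > 0" by (simp add: e_def)
  obtain d0 where d0: "d0 > 0" "ball x d0 \<subseteq> S"
    using assms(1,2) openE by blast
  obtain d1 where d1: "d1 > 0" "\<And>y. dist y x < d1 \<Longrightarrow> dist (fu y v) (fu x v) < e"
    using cu e unfolding continuous_at_eps_delta by blast
  obtain d2 where d2: "d2 > 0" "\<And>y. dist y x < d2 \<Longrightarrow> dist (fv y u) (fv x u) < e"
    using cv e unfolding continuous_at_eps_delta by blast
  define d where "d = min d0 (min d1 d2)"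
  \<comment> \<open>Moving by at most \<open>t\<close> along \<open>u\<close> and along
    \<open>v\<close> then stays within \<open>d\<close> of \<open>x\<close>. The summand 1 makes
    this bound strict and keeps the denominator positive when both vectors vanish.\<close>
  define t where "t = d / (norm u + norm v + 1)"
  have d: "d > 0" using d0 d1 d2 by (simp add: d_def)
  have pos: "norm u + norm v + 1 > 0"
    using norm_ge_zero[of u] norm_ge_zero[of v] by linarith
  have t: "t > 0"
    using d pos by (simp add: t_def)
  have near: "dist (x + s *\<^sub>R u + r *\<^sub>R v) x < d"
    if "0 \<le> s" "s \<le> t" "0 \<le> r" "r \<le> t" for s r
  proof -
    have "dist (x + s *\<^sub>R u + r *\<^sub>R v) x \<le> s * norm u + r * norm v"
      using norm_triangle_ineq[of "s *\<^sub>R u" "r *\<^sub>R v"] that by (simp add: dist_norm add.assoc)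
    also have "\<dots> \<le> t * norm u + t * norm v"
      using that by (intro add_mono mult_right_mono) auto
    also have "\<dots> < t * (norm u + norm v + 1)"
      using t by (simp add: algebra_simps)
    also have "\<dots> = d"
      using pos by (simp add: t_def)
    finally show ?thesis .
  qed
  have S: "x + s *\<^sub>R u + r *\<^sub>R v \<in> S" if "0 \<le> s" "s \<le> t" "0 \<le> r" "r \<le> t" for s r
    using near[OF that] d0 by (auto simp: d_def dist_commute subset_iff)
  have S': "x + s *\<^sub>R v + r *\<^sub>R u \<in> S" if "0 \<le> s" "s \<le> t" "0 \<le> r" "r \<le> t" for s r
    using S[of r s] that by (simp add: algebra_simps)
  obtain s r where sr: "0 \<le> s" "s \<le> t" "0 \<le> r" "r \<le> t" and
    1: "f (x + t *\<^sub>R u + t *\<^sub>R v) - f (x + t *\<^sub>R u) - f (x + t *\<^sub>R v) + f x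
      = t * t * fu (x + s *\<^sub>R u + r *\<^sub>R v) v"
    by (rule double_difference_mvt[OF t S f fu])
  obtain s' r' where sr': "0 \<le> s'" "s' \<le> t" "0 \<le> r'" "r' \<le> t" and
    2: "f (x + t *\<^sub>R v + t *\<^sub>R u) - f (x + t *\<^sub>R v) - f (x + t *\<^sub>R u) + f x
      = t * t * fv (x + s' *\<^sub>R v + r' *\<^sub>R u) u"
    by (rule double_difference_mvt[OF t S' f fv])
  \<comment> \<open>The left-hand sides of the two expansions are the same number, and the positive
    factor \<open>t * t\<close> cancels.\<close>
  have "fu (x + s *\<^sub>R u + r *\<^sub>R v) v = fv (x + r' *\<^sub>R u + s' *\<^sub>R v) u"
  proof -
    have "t * t * fu (x + s *\<^sub>R u + r *\<^sub>R v) v = t * t * fv (x + s' *\<^sub>R v + r' *\<^sub>R u) u"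
      using 1 2 by (simp add: algebra_simps)
    then show ?thesis using t by (simp add: algebra_simps)
  qed
  moreover have "dist (fu (x + s *\<^sub>R u + r *\<^sub>R v) v) (fu x v) < e"
    by (rule d1) (use near[OF sr] in \<open>simp add: d_def\<close>)
  moreover have "dist (fv (x + r' *\<^sub>R u + s' *\<^sub>R v) u) (fv x u) < e"
    by (rule d2) (use near[OF sr'(3,4,1,2)] in \<open>simp add: d_def\<close>)
  ultimately have "dist (fu x v) (fv x u) < 2 * e"
    by (metis dist_commute dist_triangle_less_add mult_2)
  then show False by (simp add: e_def)
qed

lemma second_derivative_symmetric:
  fixes f :: "'e::real_normed_vector \<Rightarrow> 'f::euclidean_space"
  assumes "open S" "x \<in> S"
    and f: "\<And>y. y \<in> S \<Longrightarrow> (f has_derivative f' y) (at y)"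
    and fu: "\<And>y. y \<in> S \<Longrightarrow> ((\<lambda>y. f' y u) has_derivative fu y) (at y)"
    and fv: "\<And>y. y \<in> S \<Longrightarrow> ((\<lambda>y. f' y v) has_derivative fv y) (at y)"
    and cu: "continuous (at x) (\<lambda>y. fu y v)" and cv: "continuous (at x) (\<lambda>y. fv y u)"
  shows "fu x v = fv x u"
proof (rule euclidean_eqI)
  fix b :: 'f
  show "fu x v \<bullet> b = fv x u \<bullet> b"
    by (rule second_derivative_symmetric_real[OF assms(1,2), of "\<lambda>y. f y \<bullet> b" "\<lambda>y h. f' y h \<bullet> b"
          u "\<lambda>y h. fu y h \<bullet> b" v "\<lambda>y h. fv y h \<bullet> b"])
      (intro has_derivative_inner_left f fu fv continuous_intros cu cv; assumption)+
qed

lemma smooth_second_derivative_symmetric: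
  fixes F :: "'e::euclidean_space \<Rightarrow> 'f::euclidean_space"
  assumes S: "open S" "x \<in> S" and F: "smooth_on S F"
  shows "frechet_derivative (\<lambda>y. frechet_derivative F (at y) u) (at x) v
    = frechet_derivative (\<lambda>y. frechet_derivative F (at y) v) (at x) u"
proof -
  have Ck: "Ck_on (Suc (Suc 0)) S F"
    using F by (simp only: smooth_on_def)
  have 1: "(F has_derivative frechet_derivative F (at y)) (at y)" if "y \<in> S" for y
    using Ck that by (simp add: frechet_derivative_works)
  have 2: "((\<lambda>y. frechet_derivative F (at y) w) has_derivative
      frechet_derivative (\<lambda>y. frechet_derivative F (at y) w) (at y)) (at y)" if "y \<in> S" for y w
    using Ck that by (simp add: frechet_derivative_works)
  have 3: "continuous (at x) (\<lambda>y. frechet_derivative (\<lambda>y. frechet_derivative F (at y) w) (at y) z)"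
    for w z
    using Ck S by (simp add: continuous_on_eq_continuous_at)
  show ?thesis
    by (rule second_derivative_symmetric[OF S 1 2 2 3 3])
qed

section \<open>Differentiating bilinear forms that vary with the point\<close>

lemma bilinear_expand:
  fixes B :: "'e::euclidean_space \<Rightarrow> 'e \<Rightarrow> real"
  assumes "bilinear B"
  shows "B u v = (\<Sum>i\<in>Basis. \<Sum>j\<in>Basis. (u \<bullet> i) * (v \<bullet> j) * B i j)"
proof -
  have "B u v = B (\<Sum>i\<in>Basis. (u \<bullet> i) *\<^sub>R i) (\<Sum>j\<in>Basis. (v \<bullet> j) *\<^sub>R j)"
    by (simp add: euclidean_representation)
  also have "\<dots> = (\<Sum>i\<in>Basis. \<Sum>j\<in>Basis. B ((u \<bullet> i) *\<^sub>R i) ((v \<bullet> j) *\<^sub>R j))"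
    by (simp add: bilinear_sum[OF assms] sum.cartesian_product)
  finally show ?thesis
    by (simp add: bilinear_lmul[OF assms] bilinear_rmul[OF assms] mult_ac)
qed

text \<open>In a basis the expression is a finite sum of products of real functions, to which the
  usual product rule applies. The inner map \<open>F\<close> lets one statement serve for fields on
  a single domain, with \<open>F\<close> the identity, and for pullbacks.\<close>

lemma has_derivative_bilinear_family:
  fixes G :: "'e::euclidean_space \<Rightarrow> 'e \<Rightarrow> 'e \<Rightarrow> real" and F A B :: "'f::real_normed_vector \<Rightarrow> 'e"
  assumes T: "open T" "F x \<in> T" and bil: "\<And>p. p \<in> T \<Longrightarrow> bilinear (G p)"
    and G: "\<And>u v. ((\<lambda>p. G p u v) has_derivative G' u v) (at (F x))"
    and F: "(F has_derivative F') (at x)"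
    and A: "(A has_derivative A') (at x)" and B: "(B has_derivative B') (at x)"
  shows "((\<lambda>y. G (F y) (A y) (B y)) has_derivative
    (\<lambda>h. G' (A x) (B x) (F' h) + G (F x) (A' h) (B x) + G (F x) (A x) (B' h))) (at x)"
proof -
  \<comment> \<open>\<open>G'\<close> is given only as a derivative for each pair \<open>u\<close>,
    \<open>v\<close>; uniqueness of the derivative forces the bilinear expansion on it.\<close>
  have G': "G' u v = (\<lambda>h. \<Sum>i\<in>Basis. \<Sum>j\<in>Basis. (u \<bullet> i) * (v \<bullet> j) * G' i j h)" for u v
  proof -
    have "((\<lambda>p. \<Sum>i\<in>Basis. \<Sum>j\<in>Basis. (u \<bullet> i) * (v \<bullet> j) * G p i j) has_derivative
        (\<lambda>h. \<Sum>i\<in>Basis. \<Sum>j\<in>Basis. (u \<bullet> i) * (v \<bullet> j) * G' i j h)) (at (F x))"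
      by (intro has_derivative_sum has_derivative_mult_right G)
    then have "((\<lambda>p. G p u v) has_derivative
        (\<lambda>h. \<Sum>i\<in>Basis. \<Sum>j\<in>Basis. (u \<bullet> i) * (v \<bullet> j) * G' i j h)) (at (F x))"
      by (rule has_derivative_transform_within_open[OF _ T])
        (rule bilinear_expand[OF bil, symmetric])
    then show ?thesis by (rule has_derivative_unique[OF G])
  qed
  \<comment> \<open>Bilinearity is known over \<open>T\<close> only, so the basis expansion
    represents the function just near \<open>x\<close>, where continuity keeps \<open>F y\<close> in
    \<open>T\<close>.\<close>
  have ev: "\<forall>\<^sub>F y in at x. F y \<in> T"
    using has_derivative_continuous[OF F] T
    by (auto simp: continuous_at intro: topological_tendstoD)
  have GF: "((\<lambda>y. G (F y) u v) has_derivative (\<lambda>h. G' u v (F' h))) (at x)" for u v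
    by (rule has_derivative_compose[OF F G])
  have "((\<lambda>y. \<Sum>i\<in>Basis. \<Sum>j\<in>Basis. (A y \<bullet> i) * (B y \<bullet> j) * G (F y) i j) has_derivative
      (\<lambda>h. \<Sum>i\<in>Basis. \<Sum>j\<in>Basis. (A x \<bullet> i) * (B x \<bullet> j) * G' i j (F' h)
        + ((A x \<bullet> i) * (B' h \<bullet> j) + (A' h \<bullet> i) * (B x \<bullet> j)) * G (F x) i j)) (at x)"
    by (intro has_derivative_sum has_derivative_mult GF has_derivative_inner_left A B)
  moreover have "(\<Sum>i\<in>Basis. \<Sum>j\<in>Basis. (A x \<bullet> i) * (B x \<bullet> j) * G' i j (F' h)
        + ((A x \<bullet> i) * (B' h \<bullet> j) + (A' h \<bullet> i) * (B x \<bullet> j)) * G (F x) i j)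
      = G' (A x) (B x) (F' h) + G (F x) (A' h) (B x) + G (F x) (A x) (B' h)" for h
    using bilinear_expand[OF bil[OF T(2)], of "A x" "B' h"]
      bilinear_expand[OF bil[OF T(2)], of "A' h" "B x"] fun_cong[OF G'[of "A x" "B x"], of "F' h"]
    by (simp only: sum.distrib distrib_right)
  ultimately have "((\<lambda>y. \<Sum>i\<in>Basis. \<Sum>j\<in>Basis. (A y \<bullet> i) * (B y \<bullet> j) * G (F y) i j)
      has_derivative
      (\<lambda>h. G' (A x) (B x) (F' h) + G (F x) (A' h) (B x) + G (F x) (A x) (B' h))) (at x)"
    by (simp only:)
  moreover have "(\<Sum>i\<in>Basis. \<Sum>j\<in>Basis. (A y \<bullet> i) * (B y \<bullet> j) * G (F y) i j)
      = G (F y) (A y) (B y)" if "F y \<in> T" for y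
    by (rule bilinear_expand[OF bil[OF that], symmetric])
  ultimately show ?thesis
    using T(2) by (elim has_derivative_transform_eventually) (auto intro: eventually_mono[OF ev])
qed

section \<open>The Lie derivative of a metric\<close>

lemma lie_bracket_const:
  "lie_bracket V (\<lambda>_. u) x = - frechet_derivative V (at x) u"
  by (simp add: lie_bracket_def)

lemma lie_deriv_metric_const:
  assumes "bilinear (g x)"
  shows "lie_deriv_metric V g (\<lambda>_. u) (\<lambda>_. v) x =
    frechet_derivative (\<lambda>y. g y u v) (at x) (V x)
      + g x (frechet_derivative V (at x) u) v + g x u (frechet_derivative V (at x) v)"
  by (simp add: lie_deriv_metric_def lie_bracket_const dir_deriv_def bilinear_lneg[OF assms]
      bilinear_rneg[OF assms])

text \<open>The product rule produces the derivatives of \<open>Y\<close> and \<open>Z\<close> along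
  \<open>V\<close>, and these cancel against the same terms in the brackets. Later computations can
  therefore use constant fields.\<close>

lemma lie_deriv_metric_tensorial:
  fixes g :: "'e::euclidean_space \<Rightarrow> 'e \<Rightarrow> 'e \<Rightarrow> real"
  assumes T: "open T" "x \<in> T" and bil: "\<And>p. p \<in> T \<Longrightarrow> bilinear (g p)"
    and g: "\<And>u v. (\<lambda>p. g p u v) differentiable (at x)"
    and Y: "Y differentiable (at x)" and Z: "Z differentiable (at x)"
  shows "lie_deriv_metric V g Y Z x = lie_deriv_metric V g (\<lambda>_. Y x) (\<lambda>_. Z x) x"
proof -
  note b = bil[OF T(2)]
  have "((\<lambda>y. g y (Y y) (Z y)) has_derivative
    (\<lambda>h. frechet_derivative (\<lambda>p. g p (Y x) (Z x)) (at x) h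
      + g x (frechet_derivative Y (at x) h) (Z x) + g x (Y x) (frechet_derivative Z (at x) h))) (at x)"
    by (rule has_derivative_bilinear_family[where F = "\<lambda>y. y", OF T bil _ has_derivative_ident])
      (use g Y Z in \<open>simp_all add: frechet_derivative_works\<close>)
  then have "dir_deriv V (\<lambda>y. g y (Y y) (Z y)) x
    = frechet_derivative (\<lambda>p. g p (Y x) (Z x)) (at x) (V x)
      + g x (frechet_derivative Y (at x) (V x)) (Z x) + g x (Y x) (frechet_derivative Z (at x) (V x))"
    by (simp add: dir_deriv_def frechet_derivative_at[symmetric])
  then show ?thesis
    by (simp add: lie_deriv_metric_const[of g, OF b])
      (simp add: lie_deriv_metric_def lie_bracket_def bilinear_lsub[OF b] bilinear_rsub[OF b])
qed

text \<open>Naturality of the Lie derivative. Second derivatives of \<open>F\<close> arise from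
  differentiating the pulled back metric and, with the opposite sign, from differentiating the
  relation between \<open>V\<close> and \<open>W\<close>; by their symmetry they cancel. As
  \<open>F\<close> may go into a space of larger dimension, the fields are tied by relatedness and
  not by a push-forward.\<close>

lemma lie_deriv_metric_pullback:
  fixes F :: "'f::euclidean_space \<Rightarrow> 'e::euclidean_space"
  assumes S: "open S" "x \<in> S" and F: "smooth_on S F"
    and T: "open T" "F x \<in> T" and bil: "\<And>p. p \<in> T \<Longrightarrow> bilinear (g p)"
    and dg: "\<And>u v. (\<lambda>p. g p u v) differentiable (at (F x))"
    and V: "V differentiable (at x)" and W: "W differentiable (at (F x))"
    and rel: "\<And>y. y \<in> S \<Longrightarrow> frechet_derivative F (at y) (V y) = W (F y)"
    and h: "\<And>y u v. y \<in> S \<Longrightarrow>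
      h y u v = g (F y) (frechet_derivative F (at y) u) (frechet_derivative F (at y) v)"
  shows "lie_deriv_metric V h (\<lambda>_. u) (\<lambda>_. v) x =
    lie_deriv_metric W g (\<lambda>_. frechet_derivative F (at x) u) (\<lambda>_. frechet_derivative F (at x) v) (F x)"
proof -
  define DF where "DF y = frechet_derivative F (at y)" for y
  define DDF where "DDF w = frechet_derivative (\<lambda>y. DF y w) (at x)" for w
  define DV where "DV = frechet_derivative V (at x)"
  define DW where "DW = frechet_derivative W (at (F x))"
  note b = bil[OF T(2)]
  have Ck: "Ck_on (Suc (Suc 0)) S F"
    using F by (simp only: smooth_on_def)
  have hF: "(F has_derivative DF y) (at y)" if "y \<in> S" for y
    using Ck that by (simp add: frechet_derivative_works DF_def)
  have hDF: "((\<lambda>y. DF y w) has_derivative DDF w) (at x)" for w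
    using Ck S(2) by (simp add: frechet_derivative_works DF_def DDF_def)
  have hV: "(V has_derivative DV) (at x)" and hW: "(W has_derivative DW) (at (F x))"
    using V W by (simp_all add: frechet_derivative_works DV_def DW_def)
  have linDF: "linear (DF y)" if "y \<in> S" for y
    using has_derivative_linear[OF hF[OF that]] .
  have sym: "DDF w z = DDF z w" for w z
    unfolding DDF_def DF_def by (rule smooth_second_derivative_symmetric[OF S F])
  have lin_expand: "L w = (\<Sum>i\<in>Basis. (w \<bullet> i) *\<^sub>R L i)" if "linear L" for L :: "'f \<Rightarrow> 'e" and w
  proof -
    have "L w = L (\<Sum>i\<in>Basis. (w \<bullet> i) *\<^sub>R i)"
      by (simp only: euclidean_representation)
    then show ?thesis
      by (simp only: linear_sum[OF that] linear_cmul[OF that])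
  qed
  have DF_V: "DF y w = (\<Sum>i\<in>Basis. (w \<bullet> i) *\<^sub>R DF y i)" if "y \<in> S" for y w
    by (rule lin_expand[OF linDF[OF that]])
  \<comment> \<open>As a derivative, \<open>DDF w z\<close> is linear in \<open>z\<close>; symmetry
    carries this over to \<open>w\<close>.\<close>
  have DDF_V: "DDF w z = (\<Sum>i\<in>Basis. (w \<bullet> i) *\<^sub>R DDF i z)" for w z
    using lin_expand[OF has_derivative_linear[OF hDF], of z w] by (simp only: sym[of z])
  \<comment> \<open>Differentiability of \<open>DF y w\<close> is available for fixed
    \<open>w\<close>, so \<open>DF y (V y)\<close> is expanded in a basis before it is
    differentiated.\<close>
  have "((\<lambda>y. \<Sum>i\<in>Basis. (V y \<bullet> i) *\<^sub>R DF y i) has_derivative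
      (\<lambda>w. \<Sum>i\<in>Basis. (V x \<bullet> i) *\<^sub>R DDF i w + (DV w \<bullet> i) *\<^sub>R DF x i)) (at x)"
    by (intro has_derivative_sum has_derivative_scaleR has_derivative_inner_left hV hDF)
  then have "((\<lambda>y. \<Sum>i\<in>Basis. (V y \<bullet> i) *\<^sub>R DF y i) has_derivative
      (\<lambda>w. DDF (V x) w + DF x (DV w))) (at x)"
    by (simp only: sum.distrib DDF_V[of "V x", symmetric] DF_V[OF S(2), symmetric])
  then have "((\<lambda>y. W (F y)) has_derivative (\<lambda>w. DDF (V x) w + DF x (DV w))) (at x)"
    by (rule has_derivative_transform_within_open[OF _ S])
      (use rel in \<open>simp only: DF_V[symmetric], simp only: DF_def\<close>)
  \<comment> \<open>The relatedness equation is differentiated on both sides: the derivative just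
    found is compared with the chain rule for \<open>W\<close> after \<open>F\<close>.\<close>
  from fun_cong[OF has_derivative_unique[OF this has_derivative_compose[OF hF[OF S(2)] hW]]]
  have diff_rel: "DF x (DV w) = DW (DF x w) - DDF w (V x)" for w
    by (simp add: sym[of "V x"] algebra_simps)
  have "((\<lambda>y. g (F y) (DF y u) (DF y v)) has_derivative
    (\<lambda>w. frechet_derivative (\<lambda>p. g p (DF x u) (DF x v)) (at (F x)) (DF x w)
      + g (F x) (DDF u w) (DF x v) + g (F x) (DF x u) (DDF v w))) (at x)"
    by (rule has_derivative_bilinear_family[OF T bil _ hF[OF S(2)] hDF hDF])
      (use dg in \<open>simp_all add: frechet_derivative_works\<close>)
  then have "((\<lambda>y. h y u v) has_derivative
    (\<lambda>w. frechet_derivative (\<lambda>p. g p (DF x u) (DF x v)) (at (F x)) (DF x w)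
      + g (F x) (DDF u w) (DF x v) + g (F x) (DF x u) (DDF v w))) (at x)"
    by (rule has_derivative_transform_within_open[OF _ S]) (simp add: h DF_def)
  then have 1: "frechet_derivative (\<lambda>y. h y u v) (at x) (V x)
      = frechet_derivative (\<lambda>p. g p (DF x u) (DF x v)) (at (F x)) (W (F x))
        + g (F x) (DDF u (V x)) (DF x v) + g (F x) (DF x u) (DDF v (V x))"
    using rel[OF S(2)] by (simp add: frechet_derivative_at[symmetric] DF_def[symmetric])
  have hx: "h x = (\<lambda>u v. g (F x) (DF x u) (DF x v))"
    by (simp add: fun_eq_iff h S(2) DF_def)
  have bh: "bilinear (h x)"
    unfolding hx bilinear_def
    by (auto intro!: linearI simp: linear_add[OF linDF[OF S(2)]] linear_cmul[OF linDF[OF S(2)]]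
      bilinear_ladd[OF b] bilinear_radd[OF b] bilinear_lmul[OF b] bilinear_rmul[OF b])
  show ?thesis
    unfolding lie_deriv_metric_const[of h, OF bh] lie_deriv_metric_const[of g, OF b] 1
      DF_def[symmetric] DV_def[symmetric] DW_def[symmetric]
    by (simp add: hx diff_rel bilinear_lsub[OF b] bilinear_rsub[OF b])
qed

section \<open>Killing fields through the Levi-Civita connection\<close>

text \<open>Metric compatibility turns the derivative of \<open>g\<close> along \<open>V\<close>
  into two terms with \<open>christoffel\<close>. Its symmetry puts \<open>V x\<close> in the second
  slot, where each term joins the derivative of \<open>V\<close> to form a covariant
  derivative.\<close>

lemma lie_deriv_metric_levi_civita:
  assumes M: "riemannian_metric M g" and c: "c \<in> atlas M" and op: "open (chart_img c)"
    and x: "x \<in> chart_img c"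
  shows "lie_deriv_metric V (g c) (\<lambda>_. u) (\<lambda>_. v) x =
    g c x (levi_civita (g c) (\<lambda>_. u) V x) v + g c x u (levi_civita (g c) (\<lambda>_. v) V x)"
proof -
  have b: "bilinear (g c x)"
    using M c x by (auto simp: riemannian_metric_def)
  have "frechet_derivative (\<lambda>y. g c y u v) (at x) (V x)
      = g c x (christoffel (g c) x u (V x)) v + g c x u (christoffel (g c) x v (V x))"
    using is_christoffel_christoffel[OF assms] unfolding is_christoffel_def by metis
  then show ?thesis
    by (simp add: lie_deriv_metric_const[of "g c", OF b] levi_civita_def bilinear_ladd[OF b]
        bilinear_radd[OF b])
qed

lemma smooth_on_const: "smooth_on S (\<lambda>_. u)"
proof -
  have "Ck_on k S (\<lambda>_. u)" for k
    by (induction k arbitrary: u) auto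
  then show ?thesis by (simp add: smooth_on_def)
qed

text \<open>Inserting the structure equation leaves a multiple of
  \<open>g (\<phi> u) v + g u (\<phi> v)\<close>, which vanishes as \<phi> is skew.\<close>

lemma sq_sasakian_killing:
  assumes sq: "sq_sasakian M \<phi> \<xi> \<eta> g" and c: "c \<in> atlas M" and x: "x \<in> chart_img c"
  shows "lie_deriv_metric (\<xi> c) (g c) (\<lambda>_. u) (\<lambda>_. v) x = 0"
proof -
  have acm: "almost_contact_metric M \<phi> \<xi> \<eta> g"
    using sq by (simp add: sq_sasakian_def)
  have M: "riemannian_metric M g" and op: "open (chart_img c)"
    and skew: "g c x (\<phi> c x u) v = - g c x u (\<phi> c x v)"
    using acm c x unfolding almost_contact_metric_def smooth_manifold_def by blast+
  have b: "bilinear (g c x)"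
    using M c x by (auto simp: riemannian_metric_def)
  \<comment> \<open>Here \<beta> is a real number, the value of the structure function at the point
    under consideration. The structure equation is evaluated on the constant fields
    \<open>w\<close>.\<close>
  obtain \<beta> where "levi_civita (g c) (\<lambda>_. w) (\<xi> c) x = - (\<beta> *\<^sub>R \<phi> c x w)" for w
    using sq c x smooth_on_const unfolding sq_sasakian_def by blast
  then show ?thesis
    by (simp add: lie_deriv_metric_levi_civita[OF M c op x] bilinear_lneg[OF b]
        bilinear_rneg[OF b] bilinear_lmul[OF b] bilinear_rmul[OF b] skew)
qed

section \<open>Charts and coordinate changes for a submanifold\<close>

lemma chart_inv_in_dom: "x \<in> chart_img c \<Longrightarrow> chart_inv c x \<in> chart_dom c"
  by (simp add: chart_img_def chart_inv_def inv_into_into)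

lemma chart_map_chart_inv: "x \<in> chart_img c \<Longrightarrow> chart_map c (chart_inv c x) = x"
  by (simp add: chart_img_def chart_inv_def f_inv_into_f)

lemma chart_homeomorphic_map:
  assumes "smooth_manifold M" "c \<in> atlas M"
  shows "homeomorphic_map (subtopology (topo M) (chart_dom c)) (top_of_set (chart_img c))
    (chart_map c)"
  using assms by (simp add: smooth_manifold_def)

lemma chart_dom_subset:
  assumes "smooth_manifold M" "c \<in> atlas M"
  shows "chart_dom c \<subseteq> topspace (topo M)"
  using assms by (auto simp: smooth_manifold_def)

lemma chart_inv_chart_map:
  assumes M: "smooth_manifold M" and c: "c \<in> atlas M" and p: "p \<in> chart_dom c"
  shows "chart_inv c (chart_map c p) = p"
proof -
  have "inj_on (chart_map c) (chart_dom c)"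
    using chart_homeomorphic_map[OF M c] chart_dom_subset[OF M c]
    by (simp add: homeomorphic_eq_everything_map Int_absorb1)
  then show ?thesis using p by (simp add: chart_inv_def)
qed

lemma overlap_iff:
  assumes "smooth_manifold M" "c \<in> atlas M"
  shows "x \<in> overlap c d \<longleftrightarrow> x \<in> chart_img c \<and> chart_inv c x \<in> chart_dom d"
proof
  show "x \<in> overlap c d \<Longrightarrow> x \<in> chart_img c \<and> chart_inv c x \<in> chart_dom d"
    using chart_inv_chart_map[OF assms] by (auto simp: overlap_def chart_img_def)
  assume "x \<in> chart_img c \<and> chart_inv c x \<in> chart_dom d"
  then show "x \<in> overlap c d"
    unfolding overlap_def using chart_inv_in_dom chart_map_chart_inv by (metis IntI image_eqI)
qed

text \<open>The inclusion is continuous, even if the topology of \<open>N\<close> is finer than the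
  induced one, so the ambient chart domain cuts out an open set of \<open>N\<close>; the chart map
  of \<open>c\<close> is open. Openness lets identities valid on an overlap be
  differentiated.\<close>

lemma open_overlap:
  assumes N: "submanifold N M" and M: "smooth_manifold M"
    and c: "c \<in> atlas N" and d: "d \<in> atlas M"
  shows "open (overlap c d)"
proof -
  have sN: "smooth_manifold N" and cont: "continuous_map (topo N) (topo M) id"
    using N by (simp_all add: submanifold_def)
  have "openin (topo M) (chart_dom d)"
    using M d by (simp add: smooth_manifold_def)
  then have "openin (topo N) {p \<in> topspace (topo N). id p \<in> chart_dom d}"
    by (rule openin_continuous_map_preimage[OF cont])
  moreover have "chart_dom c \<inter> {p \<in> topspace (topo N). id p \<in> chart_dom d}
      = chart_dom c \<inter> chart_dom d"
    using chart_dom_subset[OF sN c] by auto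
  ultimately have "openin (subtopology (topo N) (chart_dom c)) (chart_dom c \<inter> chart_dom d)"
    using openin_subtopology_Int2 by metis
  then have "openin (top_of_set (chart_img c)) (overlap c d)"
    unfolding overlap_def
    using homeomorphic_imp_open_map[OF chart_homeomorphic_map[OF sN c]] by (simp add: open_map_def)
  moreover have "open (chart_img c)"
    using sN c by (simp add: smooth_manifold_def)
  ultimately show ?thesis using openin_open_trans by blast
qed

lemma chart_at:
  assumes "smooth_manifold M" "p \<in> topspace (topo M)"
  shows "chart_at M p \<in> atlas M" "p \<in> chart_dom (chart_at M p)"
proof -
  have "\<exists>d. d \<in> atlas M \<and> p \<in> chart_dom d"
    using assms by (auto simp: smooth_manifold_def)
  from someI_ex[OF this] show "chart_at M p \<in> atlas M" "p \<in> chart_dom (chart_at M p)"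
    by (simp_all add: chart_at_def)
qed

lemma transition_in_overlap:
  assumes "x \<in> overlap c d" "x \<in> overlap c e" "smooth_manifold N" "c \<in> atlas N"
  shows "transition c d x \<in> overlap d e"
  using assms by (auto simp: overlap_iff overlap_def[of d] transition_def)

lemma transition_comp:
  assumes M: "smooth_manifold M" and d: "d \<in> atlas M" and N: "smooth_manifold N" "c \<in> atlas N"
    and x: "x \<in> overlap c d"
  shows "transition d e (transition c d x) = transition c e x"
  using x chart_inv_chart_map[OF M d] by (simp add: overlap_iff[OF N] transition_def)

lemma has_derivative_transition:
  assumes "smooth_on (overlap c d) (transition c d)" "x \<in> overlap c d"
  shows "(transition c d has_derivative dtransition c d x) (at x)"
  using smooth_on_differentiable[OF assms] by (simp add: dtransition_def frechet_derivative_works)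

text \<open>The chain rule, with \<open>c\<close> a chart of the submanifold and \<open>d\<close>,
  \<open>e\<close> ambient charts. The factorization through \<open>d\<close> holds on all of
  \<open>overlap c d\<close>, an open neighbourhood of \<open>x\<close>, so the derivatives
  agree.\<close>

lemma dtransition_comp:
  assumes N: "submanifold N M" and M: "smooth_manifold M" and c: "c \<in> atlas N"
    and d: "d \<in> atlas M" and e: "e \<in> atlas M"
    and x: "x \<in> overlap c d" "x \<in> overlap c e"
  shows "dtransition c e x = dtransition d e (transition c d x) \<circ> dtransition c d x"
proof -
  have sN: "smooth_manifold N" and sm: "\<And>d. d \<in> atlas M \<Longrightarrow> smooth_on (overlap c d) (transition c d)"
    using N c by (simp_all add: submanifold_def)
  have sde: "smooth_on (overlap d e) (transition d e)"
    using M d e by (simp add: smooth_manifold_def)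
  have "(transition d e \<circ> transition c d has_derivative
      dtransition d e (transition c d x) \<circ> dtransition c d x) (at x)"
    using has_derivative_transition[OF sm[OF d] x(1)]
      has_derivative_transition[OF sde transition_in_overlap[OF x sN c]]
    by (rule diff_chain_at)
  then have "(transition c e has_derivative
      dtransition d e (transition c d x) \<circ> dtransition c d x) (at x)"
    by (rule has_derivative_transform_within_open[OF _ open_overlap[OF N M c d] x(1)])
      (simp add: transition_comp[OF M d sN c])
  then show ?thesis
    using has_derivative_unique[OF has_derivative_transition[OF sm[OF e] x(2)]] by blast
qed

lemma overlap_chart_at:
  assumes N: "submanifold N M" and M: "smooth_manifold M" and c: "c \<in> atlas N"
    and x: "x \<in> chart_img c"
  shows "chart_at M (chart_inv c x) \<in> atlas M" "x \<in> overlap c (chart_at M (chart_inv c x))"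
proof -
  have sN: "smooth_manifold N" using N by (simp add: submanifold_def)
  have "chart_inv c x \<in> topspace (topo M)"
    using N chart_inv_in_dom[OF x] chart_dom_subset[OF sN c] by (auto simp: submanifold_def)
  from chart_at[OF M this] x
  show "chart_at M (chart_inv c x) \<in> atlas M" "x \<in> overlap c (chart_at M (chart_inv c x))"
    by (auto simp: overlap_iff[OF sN c])
qed

section \<open>The induced metric and the restricted field in arbitrary ambient charts\<close>

text \<open>The transformation law of \<open>g\<close> and the chain rule make the choice of ambient
  chart immaterial. This is essential for differentiation: \<open>chart_at\<close> may jump from
  point to point, whereas here one \<open>d\<close> serves on a whole neighbourhood.\<close>

lemma induced_metric_eq:
  assumes N: "submanifold N M" and M: "smooth_manifold M" and g: "riemannian_metric M g"
    and c: "c \<in> atlas N" and d: "d \<in> atlas M" and x: "x \<in> overlap c d"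
  shows "induced_metric M g c x u v
    = g d (transition c d x) (dtransition c d x u) (dtransition c d x v)"
proof -
  define e where "e = chart_at M (chart_inv c x)"
  have sN: "smooth_manifold N" using N by (simp add: submanifold_def)
  have e: "e \<in> atlas M" and xe: "x \<in> overlap c e"
    using overlap_chart_at[OF N M c] x by (auto simp: e_def overlap_iff[OF sN c])
  have "g d (transition e d (transition c e x)) (dtransition e d (transition c e x) (dtransition c e x u))
      (dtransition e d (transition c e x) (dtransition c e x v))
    = g e (transition c e x) (dtransition c e x u) (dtransition c e x v)"
    using g d e transition_in_overlap[OF xe x sN c] unfolding riemannian_metric_def by blast
  then show ?thesis
    unfolding induced_metric_def e_def[symmetric] Let_def
    by (simp add: transition_comp[OF M e sN c xe] dtransition_comp[OF N M c e d xe x])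
qed

text \<open>In the chart picked by \<open>chart_at\<close>, tangency gives existence and injectivity
  of the differential gives uniqueness of the vector described by \<open>THE\<close>. The
  transformation law of \<open>V\<close> then passes to any other chart.\<close>

lemma restrict_field_eq:
  assumes N: "submanifold N M" and M: "smooth_manifold M" and V: "vector_field M V"
    and c: "c \<in> atlas N" and d: "d \<in> atlas M" and x: "x \<in> overlap c d"
    and tangent: "\<And>e. e \<in> atlas M \<Longrightarrow> x \<in> overlap c e \<Longrightarrow> V e (transition c e x) \<in> range (dtransition c e x)"
  shows "dtransition c d x (restrict_field M V c x) = V d (transition c d x)"
proof -
  define e where "e = chart_at M (chart_inv c x)"
  have sN: "smooth_manifold N" using N by (simp add: submanifold_def)
  have e: "e \<in> atlas M" and xe: "x \<in> overlap c e"
    using overlap_chart_at[OF N M c] x by (auto simp: e_def overlap_iff[OF sN c])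
  have "inj (dtransition c e x)"
    using N c e xe by (simp add: submanifold_def)
  then have "\<exists>!v. dtransition c e x v = V e (transition c e x)"
    using tangent[OF e xe] by (metis injD rangeE)
  from theI'[OF this] have "dtransition c e x (restrict_field M V c x) = V e (transition c e x)"
    by (simp add: restrict_field_def e_def Let_def)
  moreover have "V d (transition e d (transition c e x))
      = dtransition e d (transition c e x) (V e (transition c e x))"
    using V d e transition_in_overlap[OF xe x sN c] unfolding vector_field_def by blast
  ultimately show ?thesis
    by (simp add: transition_comp[OF M e sN c xe] dtransition_comp[OF N M c e d xe x])
qed

section \<open>The Killing field on the submanifold and the Einstein condition\<close>

text \<open>After reduction to constant fields, naturality along the coordinate expression of the
  inclusion moves the computation to an ambient chart, where \<xi> is Killing.\<close>

lemma lie_deriv_induced_metric_eq_0: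
  fixes N :: "('a, 'f::euclidean_space) manifold" and M :: "('a, 'e::euclidean_space) manifold"
  assumes sq: "sq_sasakian M \<phi> \<xi> \<eta> g" and inv: "invariant_submanifold N M \<phi> \<xi>"
    and h: "riemannian_metric N (induced_metric M g)"
    and V: "vector_field N (restrict_field M \<xi>)"
    and c: "c \<in> atlas N" and x: "x \<in> chart_img c"
    and Y: "Y differentiable (at x)" and Z: "Z differentiable (at x)"
  shows "lie_deriv_metric (restrict_field M \<xi> c) (induced_metric M g c) Y Z x = 0"
proof -
  have M: "smooth_manifold M" and g: "riemannian_metric M g" and \<xi>: "vector_field M \<xi>"
    using sq by (simp_all add: sq_sasakian_def almost_contact_metric_def)
  have N: "submanifold N M" and sN: "smooth_manifold N"
    using inv by (simp_all add: invariant_submanifold_def submanifold_def)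
  have opc: "open (chart_img c)"
    using sN c by (simp add: smooth_manifold_def)
  obtain d where d: "d \<in> atlas M" and xd: "x \<in> overlap c d"
    using overlap_chart_at[OF N M c x] by blast
  have opd: "open (chart_img d)"
    using M d by (simp add: smooth_manifold_def)
  have Fx: "transition c d x \<in> chart_img d"
    using xd by (auto simp: overlap_iff[OF sN c] transition_def chart_img_def[of d])
  have "lie_deriv_metric (restrict_field M \<xi> c) (induced_metric M g c) Y Z x
      = lie_deriv_metric (restrict_field M \<xi> c) (induced_metric M g c) (\<lambda>_. Y x) (\<lambda>_. Z x) x"
    using h c by (intro lie_deriv_metric_tensorial[OF opc x _ _ Y Z] smooth_on_differentiable[OF _ x])
      (auto simp: riemannian_metric_def)
  also have "\<dots> = lie_deriv_metric (\<xi> d) (g d)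
      (\<lambda>_. frechet_derivative (transition c d) (at x) (Y x))
      (\<lambda>_. frechet_derivative (transition c d) (at x) (Z x)) (transition c d x)"
  proof (rule lie_deriv_metric_pullback[where F = "transition c d",
        OF open_overlap[OF N M c d] xd _ opd Fx])
    show "smooth_on (overlap c d) (transition c d)"
      using N c d by (simp add: submanifold_def)
    show "bilinear (g d p)" if "p \<in> chart_img d" for p
      using g d that by (simp add: riemannian_metric_def)
    show "(\<lambda>p. g d p u v) differentiable at (transition c d x)" for u v
      using g d by (intro smooth_on_differentiable[OF _ Fx]) (simp add: riemannian_metric_def)
    show "restrict_field M \<xi> c differentiable at x"
      using V c by (intro smooth_on_differentiable[OF _ x]) (simp add: vector_field_def)
    show "\<xi> d differentiable at (transition c d x)"
      using \<xi> d by (intro smooth_on_differentiable[OF _ Fx]) (simp add: vector_field_def)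
    \<comment> \<open>Relatedness of the restricted field and \<xi>; invariance supplies the
      tangency of \<xi> in every ambient chart.\<close>
    show "frechet_derivative (transition c d) (at y) (restrict_field M \<xi> c y) = \<xi> d (transition c d y)"
      if "y \<in> overlap c d" for y
      using restrict_field_eq[OF N M \<xi> c d that] inv c
      by (simp add: invariant_submanifold_def dtransition_def)
    show "induced_metric M g c y u v = g d (transition c d y)
        (frechet_derivative (transition c d) (at y) u) (frechet_derivative (transition c d) (at y) v)"
      if "y \<in> overlap c d" for y u v
      using induced_metric_eq[OF N M g c d that] by (simp add: dtransition_def)
  qed
  also have "\<dots> = 0"
    by (rule sq_sasakian_killing[OF sq d Fx])
  finally show ?thesis .
qed

theorem theorem4p1:
  fixes Mstar :: "('a, 'e::euclidean_space) manifold"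
    and \<phi> :: "('a, 'e) tensor11" and \<xi> :: "('a, 'e) vfield"
    and \<eta> :: "('a, 'e) form1" and g :: "('a, 'e) tensor02"
    and M :: "('a, 'f::euclidean_space) manifold"
    and n m :: nat and lam :: real
  assumes "DIM('e) = 2 * n + 1" and "2 * n + 1 > 3"
    and "DIM('f) = 2 * m + 1" and "m < n"
    and "sq_sasakian Mstar \<phi> \<xi> \<eta> g"
    and "invariant_submanifold M Mstar \<phi> \<xi>"
    and "ricci_soliton M (induced_metric Mstar g) (restrict_field Mstar \<xi>) lam"
  shows "einstein M (induced_metric Mstar g)"
  unfolding einstein_def
\<comment> \<open>Without its Lie derivative term the soliton equation is twice
  \<open>S + lam g = 0\<close>, which dictates the constant.\<close>
proof (intro exI[of _ "- lam"] ballI allI impI)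
  fix c :: "('a, 'f) chart" and Y Z :: "'f \<Rightarrow> 'f" and x
  assume c: "c \<in> atlas M" and YZ: "smooth_on (chart_img c) Y" "smooth_on (chart_img c) Z"
    and x: "x \<in> chart_img c"
  have "lie_deriv_metric (restrict_field Mstar \<xi> c) (induced_metric Mstar g c) Y Z x = 0"
    \<comment> \<open>The definition of \<open>ricci_soliton\<close> provides that the induced
      metric is a Riemannian metric and the restricted field a smooth vector field.\<close>
    using assms(7) YZ[THEN smooth_on_differentiable, OF x]
    by (intro lie_deriv_induced_metric_eq_0[OF assms(5,6) _ _ c x]) (simp_all add: ricci_soliton_def)
  moreover have "lie_deriv_metric (restrict_field Mstar \<xi> c) (induced_metric Mstar g c) Y Z x
      + 2 * ricci (induced_metric Mstar g c) Y Z x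
      + 2 * lam * induced_metric Mstar g c x (Y x) (Z x) = 0"
    using assms(7) c YZ x unfolding ricci_soliton_def by blast
  ultimately show "ricci (induced_metric Mstar g c) Y Z x
      = - lam * induced_metric Mstar g c x (Y x) (Z x)"
    by simp
qed

end
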